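(* Let $\mathscr{T} \subset \mathscr{L}(E)$ be an abelian multiplicative semigroup of operators on a Banach space $E$, and let $F$ be a closed linear subspace of $E$ such that: (1) for any $T \in \mathscr{T}$, $T(F) = F$ and the restriction $T|_F$ of $T$ to $F$ is an isomorphism; (2) $F$ is a dual Banach space, that is, $F$ is linearly isometric to the dual space of some Banach space (and thus the closed unit ball $B_F$ of $F$ is compact with respect to a certain locally convex topology of $F$, called weak* ); (3) for any $T \in \mathscr{T}$, $T|_F$ is weak* continuous on $B_F$; (4) $\sup_{T \in \mathscr{T}} (\|T\| \cdot \|(T|_F)^{-1}\|) < \infty$. Then there exists a projection $P \in \mathscr{L}(E)$ onto $F$ that commutes with all $T \in \mathscr{T}$ if and only if $F$ is complemented in $E$. More specifically, if $F$ is complemented in $E$, then there exists a projection $Q \in \mathscr{L}(E)$ onto $F$ that commutes with all operators in $\mathscr{T}$ and satisfies: (a) $\|Q\| \leqslant \sup_{T \in \mathscr{T}} (\|T\| \cdot \|(T|_F)^{-1}\|) \cdot \lambda(E,F)$, where $\lambda(E,F) = \inf\{\|P\| : P \in \mathscr{L}(E) \text{ a projection onto } F\}$; (b) $Q$ is minimal, that is, $\|Q\| \leqslant \|P\|$ for any other projection $P$ onto $F$ that commutes with all operators in $\mathscr{T}$.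
   Context: Banach spaces are real or complex; semigroups are non-empty. $\mathscr{L}(E)$ is the algebra of all bounded linear operators from $E$ into $E$. A projection onto a closed linear subspace $F$ is a bounded linear operator $P$ with range in $F$ such that $Pf = f$ for all $f \in F$; $F$ is complemented if such a projection exists. "Isomorphism" means a linear bijection of $F$ onto $F$ that is bounded with bounded inverse; $(T|_F)^{-1}$ is the inverse as an operator on $F$. The weak* topology on $F$ is the one coming from the identification of $F$ with the dual of a fixed Banach space. *)

theory Defs
  imports "HOL-Analysis.Analysis"
begin

text \<open>
  The scalar field is a type \<open>'k\<close> of sort \<open>{real_normed_field, heine_borel}\<close>. Both \<^typ>\<open>real\<close> and
  \<^typ>\<open>complex\<close> are instances and, by the Gelfand--Mazur theorem, every type of this sort is
  isometrically isomorphic to one of the two. A Banach space over \<open>'k\<close> is a type of class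
  \<^class>\<open>banach\<close> (its underlying real Banach space) with a compatible multiplication by scalars
  from \<open>'k\<close>.
\<close>

locale normed_space_over = vector_space scale
  for scale :: "'k::real_normed_field \<Rightarrow> 'a::real_normed_vector \<Rightarrow> 'a" +
  assumes scale_of_real: "scale (of_real r) x = r *\<^sub>R x"
    and norm_scale: "norm (scale c x) = norm c * norm x"

lemma normed_space_over_real_iff:
  fixes s :: "real \<Rightarrow> 'a::real_normed_vector \<Rightarrow> 'a"
  shows "normed_space_over s \<longleftrightarrow> s = scaleR"
proof
  assume "normed_space_over s"
  then interpret normed_space_over s .
  show "s = scaleR"
    using scale_of_real by (intro ext) simp
next
  assume "s = scaleR"
  then show "normed_space_over s"
    by unfold_locales (simp_all add: algebra_simps)
qed

lemma normed_space_over_mult: "normed_space_over ((*) :: 'k::real_normed_field \<Rightarrow> 'k \<Rightarrow> 'k)"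
  by unfold_locales (simp_all add: algebra_simps scaleR_conv_of_real norm_mult)

text \<open>
  Elements of the type of bounded linear functions are only real-linear; the set below consists of
  those that are linear over \<open>'k\<close>. The operator norm is the norm of that type.
\<close>

definition bounded_operators ::
  "('k \<Rightarrow> 'a::real_normed_vector \<Rightarrow> 'a) \<Rightarrow> ('k \<Rightarrow> 'b::real_normed_vector \<Rightarrow> 'b) \<Rightarrow> ('a \<Rightarrow>\<^sub>L 'b) set"
  where "bounded_operators sa sb =
    {T. \<forall>c x. blinfun_apply T (sa c x) = sb c (blinfun_apply T x)}"

definition dual_space ::
  "('k::real_normed_field \<Rightarrow> 'g::real_normed_vector \<Rightarrow> 'g) \<Rightarrow> ('g \<Rightarrow>\<^sub>L 'k) set"
  where "dual_space s = bounded_operators s (*)"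

definition abelian_operator_semigroup ::
  "('k \<Rightarrow> 'e::real_normed_vector \<Rightarrow> 'e) \<Rightarrow> ('e \<Rightarrow>\<^sub>L 'e) set \<Rightarrow> bool"
  where "abelian_operator_semigroup s \<T> \<longleftrightarrow>
    \<T> \<noteq> {} \<and> \<T> \<subseteq> bounded_operators s s \<and>
    (\<forall>S\<in>\<T>. \<forall>T\<in>\<T>. S o\<^sub>L T \<in> \<T>) \<and>
    (\<forall>S\<in>\<T>. \<forall>T\<in>\<T>. S o\<^sub>L T = T o\<^sub>L S)"

definition projection_onto ::
  "('k \<Rightarrow> 'e::real_normed_vector \<Rightarrow> 'e) \<Rightarrow> 'e set \<Rightarrow> ('e \<Rightarrow>\<^sub>L 'e) \<Rightarrow> bool"
  where "projection_onto s F P \<longleftrightarrow>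
    P \<in> bounded_operators s s \<and> range (blinfun_apply P) \<subseteq> F \<and> (\<forall>f\<in>F. blinfun_apply P f = f)"

definition complemented :: "('k \<Rightarrow> 'e::real_normed_vector \<Rightarrow> 'e) \<Rightarrow> 'e set \<Rightarrow> bool"
  where "complemented s F \<longleftrightarrow> (\<exists>P. projection_onto s F P)"

definition projection_constant :: "('k \<Rightarrow> 'e::real_normed_vector \<Rightarrow> 'e) \<Rightarrow> 'e set \<Rightarrow> real"
  where "projection_constant s F = Inf {norm P |P. projection_onto s F P}"

definition commutes_with_all :: "('e::real_normed_vector \<Rightarrow>\<^sub>L 'e) \<Rightarrow> ('e \<Rightarrow>\<^sub>L 'e) set \<Rightarrow> bool"
  where "commutes_with_all P \<T> \<longleftrightarrow> (\<forall>T\<in>\<T>. P o\<^sub>L T = T o\<^sub>L P)"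

text \<open>
  Operators on a subspace \<open>F\<close> are functions on the ambient type of which only the values on \<open>F\<close>
  matter; \<open>onorm_on\<close> is \<^const>\<open>onorm\<close> relativised to \<open>F\<close>, and \<^term>\<open>inv_into F f\<close> is the inverse
  of the restriction of \<open>f\<close> to \<open>F\<close>.
\<close>

definition bounded_operator_on ::
  "('k \<Rightarrow> 'e::real_normed_vector \<Rightarrow> 'e) \<Rightarrow> 'e set \<Rightarrow> ('e \<Rightarrow> 'e) \<Rightarrow> bool"
  where "bounded_operator_on s F f \<longleftrightarrow>
    f ` F \<subseteq> F \<and>
    (\<forall>x\<in>F. \<forall>y\<in>F. f (x + y) = f x + f y) \<and>
    (\<forall>c. \<forall>x\<in>F. f (s c x) = s c (f x)) \<and>
    (\<exists>K. \<forall>x\<in>F. norm (f x) \<le> norm x * K)"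

definition isomorphism_on ::
  "('k \<Rightarrow> 'e::real_normed_vector \<Rightarrow> 'e) \<Rightarrow> 'e set \<Rightarrow> ('e \<Rightarrow> 'e) \<Rightarrow> bool"
  where "isomorphism_on s F f \<longleftrightarrow>
    bij_betw f F F \<and> bounded_operator_on s F f \<and> bounded_operator_on s F (inv_into F f)"

definition onorm_on :: "'e::real_normed_vector set \<Rightarrow> ('e \<Rightarrow> 'e) \<Rightarrow> real"
  where "onorm_on F f = (SUP x\<in>F. norm (f x) / norm x)"

definition isometric_isomorphism_onto_dual ::
  "('k::real_normed_field \<Rightarrow> 'e::real_normed_vector \<Rightarrow> 'e) \<Rightarrow> 'e set \<Rightarrow>
   ('k \<Rightarrow> 'g::real_normed_vector \<Rightarrow> 'g) \<Rightarrow> ('e \<Rightarrow> ('g \<Rightarrow>\<^sub>L 'k)) \<Rightarrow> bool"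
  where "isometric_isomorphism_onto_dual s F sg J \<longleftrightarrow>
    bij_betw J F (dual_space sg) \<and>
    (\<forall>x\<in>F. \<forall>y\<in>F. J (x + y) = J x + J y) \<and>
    (\<forall>c. \<forall>x\<in>F. \<forall>g. blinfun_apply (J (s c x)) g = c * blinfun_apply (J x) g) \<and>
    (\<forall>x\<in>F. norm (J x) = norm x)"

text \<open>The weak* topology on the dual is the topology of pointwise convergence on the predual.\<close>

definition weak_star_dual ::
  "('k::real_normed_field \<Rightarrow> 'g::real_normed_vector \<Rightarrow> 'g) \<Rightarrow> ('g \<Rightarrow>\<^sub>L 'k) topology"
  where "weak_star_dual sg =
    pullback_topology (dual_space sg) blinfun_apply (product_topology (\<lambda>_. euclidean) UNIV)"

definition weak_star_on ::
  "'e set \<Rightarrow> ('k::real_normed_field \<Rightarrow> 'g::real_normed_vector \<Rightarrow> 'g) \<Rightarrow>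
   ('e \<Rightarrow> ('g \<Rightarrow>\<^sub>L 'k)) \<Rightarrow> 'e topology"
  where "weak_star_on F sg J = pullback_topology F J (weak_star_dual sg)"

end

theory Submission imports Defs begin

text \<open>
  Conjugation \<open>P \<mapsto> (T|\<^sub>F)\<^sup>-\<^sup>1 P T\<close> by an operator \<open>T\<close> that restricts to an isomorphism of \<open>F\<close> maps
  projections onto \<open>F\<close> to projections onto \<open>F\<close>, and it fixes exactly those that commute with \<open>T\<close>. A
  projection commuting with the whole semigroup is therefore a common fixed point of the
  conjugations. These are affine, and they commute with each other because the semigroup is abelian,
  so the fixed point comes from the Markov--Kakutani theorem, once the conjugations are known to
  act continuously on a non-empty compact convex set.

  The topology is that of pointwise weak* convergence of operators from \<open>E\<close> into \<open>F\<close>. Its closed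
  balls are compact by Tychonoff's theorem, since closed balls of \<open>F\<close> are weak* compact. Conjugation
  is continuous on balls: \<open>T|\<^sub>F\<close> is a weak* continuous injection of a compact ball into a Hausdorff
  space, so its inverse is weak* continuous on the image, and a large enough ball has any given ball
  in its image. For a projection \<open>P\<close> and \<open>C = sup \<parallel>T\<parallel> \<parallel>(T|\<^sub>F)\<^sup>-\<^sup>1\<parallel>\<close>, the compact convex set is that of
  the projections in a large ball all of whose conjugates have norm at most \<open>C \<parallel>P\<parallel>\<close>. It contains
  \<open>P\<close>, and conjugation preserves it because a conjugate of a conjugate is again a conjugate. A
  common fixed point \<open>Q\<close> is its own conjugate, whence \<open>\<parallel>Q\<parallel> \<le> C \<parallel>P\<parallel>\<close>.

  The operator norm is lower semicontinuous and the commuting projections form a closed set, so a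
  commuting projection of minimal norm exists. Its norm is at most \<open>C \<parallel>P\<parallel>\<close> for every projection \<open>P\<close>
  onto \<open>F\<close>, hence at most \<open>C\<close> times the infimum of the norms of all projections onto \<open>F\<close>.
\<close>

section \<open>Fixed points of commuting affine maps\<close>

text \<open>
  The sublevel sets at the values of \<open>h\<close> on finitely many points share the point with the least
  value, so compactness gives a point common to all sublevel sets.
\<close>

lemma attains_minimum_on_compactin:
  fixes h :: "'a \<Rightarrow> real"
  assumes K: "compactin X K" "K \<noteq> {}"
    and lsc: "\<And>c. closedin X {x \<in> K. h x \<le> c}"
  shows "\<exists>x\<in>K. \<forall>y\<in>K. h x \<le> h y"
proof -
  have "K \<inter> \<Inter>((\<lambda>y. {x \<in> K. h x \<le> h y}) ` K) \<noteq> {}"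
  proof -
    have "K \<inter> \<Inter>\<F> \<noteq> {}" if \<F>: "finite \<F>" "\<F> \<subseteq> (\<lambda>y. {x \<in> K. h x \<le> h y}) ` K" for \<F>
    proof -
      obtain Y where Y: "Y \<subseteq> K" "finite Y" "\<F> = (\<lambda>y. {x \<in> K. h x \<le> h y}) ` Y"
        using finite_subset_image[OF \<F>] by blast
      show ?thesis
      proof (cases "Y = {}")
        case True
        then show ?thesis using K Y by simp
      next
        case False
        obtain y where "y \<in> Y" "\<And>z. z \<in> Y \<Longrightarrow> h y \<le> h z"
          using arg_min_if_finite[OF Y(2) False, of h] by (meson leI)
        then have "y \<in> K \<inter> \<Inter>\<F>" using Y by auto
        then show ?thesis by blast
      qed
    qed
    then show ?thesis
      using K(1) lsc unfolding compactin_fip by auto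
  qed
  then show ?thesis by blast
qed

text \<open>
  This is the average of \<open>x, f x, f (f x), \<dots>\<close> over the first \<open>2\<^sup>m\<close> iterates, when \<open>f\<close> is affine.
  Averages over powers of two are iterated midpoints, so the binary forms of convexity and affinity
  apply to them directly.
\<close>

fun dyadic_average :: "('a::real_vector \<Rightarrow> 'a) \<Rightarrow> nat \<Rightarrow> 'a \<Rightarrow> 'a" where
  "dyadic_average f 0 x = x"
| "dyadic_average f (Suc m) x =
    midpoint (dyadic_average f m x) (dyadic_average f m ((f ^^ 2 ^ m) x))"

lemma funpow_in:
  assumes "f ` K \<subseteq> K" "x \<in> K"
  shows "(f ^^ n) x \<in> K"
  using assms by (induction n) auto

lemma dyadic_average_in:
  assumes "\<And>x y. x \<in> K \<Longrightarrow> y \<in> K \<Longrightarrow> midpoint x y \<in> K" "f ` K \<subseteq> K" "x \<in> K"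
  shows "dyadic_average f m x \<in> K"
  using assms(3) by (induction m arbitrary: x) (auto intro!: assms(1) funpow_in[OF assms(2)])

lemma dyadic_average_telescope:
  assumes mid: "\<And>x y. x \<in> K \<Longrightarrow> y \<in> K \<Longrightarrow> midpoint x y \<in> K"
    and f: "f ` K \<subseteq> K"
    and affine: "\<And>x y. x \<in> K \<Longrightarrow> y \<in> K \<Longrightarrow> f (midpoint x y) = midpoint (f x) (f y)"
    and "x \<in> K"
  shows "f (dyadic_average f m x) - dyadic_average f m x = (1 / 2 ^ m) *\<^sub>R ((f ^^ 2 ^ m) x - x)"
  using \<open>x \<in> K\<close>
proof (induction m arbitrary: x)
  case (Suc m)
  define y where "y = (f ^^ 2 ^ m) x"
  have y: "y \<in> K" unfolding y_def by (rule funpow_in[OF f Suc.prems])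
  have fy: "(f ^^ 2 ^ m) y = (f ^^ 2 ^ Suc m) x"
    by (simp add: y_def mult_2 funpow_add)
  let ?A = "dyadic_average f m"
  have "f (dyadic_average f (Suc m) x) = midpoint (f (?A x)) (f (?A y))"
    using affine[OF dyadic_average_in[OF mid f Suc.prems] dyadic_average_in[OF mid f y]]
    by (simp add: y_def)
  then have "f (dyadic_average f (Suc m) x) - dyadic_average f (Suc m) x
      = (1/2) *\<^sub>R ((f (?A x) - ?A x) + (f (?A y) - ?A y))"
    by (simp add: y_def midpoint_def algebra_simps)
  also have "\<dots> = (1/2) *\<^sub>R (1 / 2 ^ m) *\<^sub>R ((y - x) + ((f ^^ 2 ^ m) y - y))"
    unfolding Suc.IH[OF Suc.prems] Suc.IH[OF y] by (simp add: y_def algebra_simps)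
  finally show ?case unfolding fy by simp
qed simp

text \<open>
  The dyadic averages move by at most \<open>diam K / 2\<^sup>m\<close> under \<open>f\<close>, so the infimum of the displacement
  \<open>\<parallel>f x - x\<parallel>\<close> is zero; lower semicontinuity makes it attained. The bound is a norm
  bound, and the topology in which \<open>K\<close> is compact enters through the semicontinuity alone.
\<close>

lemma affine_fixed_point:
  fixes K :: "'a::real_normed_vector set"
  assumes K: "compactin X K" "K \<noteq> {}" "bounded K"
    and mid: "\<And>x y. x \<in> K \<Longrightarrow> y \<in> K \<Longrightarrow> midpoint x y \<in> K"
    and f: "f ` K \<subseteq> K"
    and affine: "\<And>x y. x \<in> K \<Longrightarrow> y \<in> K \<Longrightarrow> f (midpoint x y) = midpoint (f x) (f y)"
    and lsc: "\<And>c. closedin X {x \<in> K. norm (f x - x) \<le> c}"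
  shows "\<exists>x\<in>K. f x = x"
proof -
  obtain x where x: "x \<in> K" and min: "\<And>y. y \<in> K \<Longrightarrow> norm (f x - x) \<le> norm (f y - y)"
    using attains_minimum_on_compactin[OF K(1,2) lsc] by blast
  obtain B where B: "\<And>y. y \<in> K \<Longrightarrow> norm y \<le> B" using K(3) by (auto simp: bounded_iff)
  have "norm (f x - x) \<le> 2 * B * (1/2) ^ m" for m
  proof -
    let ?y = "dyadic_average f m x"
    have "norm (f x - x) \<le> norm (f ?y - ?y)"
      by (rule min) (rule dyadic_average_in[OF mid f x])
    also have "\<dots> = norm ((f ^^ 2 ^ m) x - x) / 2 ^ m"
      by (simp add: dyadic_average_telescope[OF mid f affine x])
    also have "\<dots> \<le> (2 * B) / 2 ^ m"
      using norm_triangle_ineq4[of "(f ^^ 2 ^ m) x" x] B[OF x] B[OF funpow_in[OF f x, of "2 ^ m"]]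
      by (intro divide_right_mono) auto
    finally show ?thesis by (simp add: power_one_over field_simps)
  qed
  moreover have "(\<lambda>m. 2 * B * (1/2) ^ m) \<longlonglongrightarrow> 2 * B * 0"
    by (intro tendsto_intros LIMSEQ_power_zero) simp
  ultimately have "norm (f x - x) \<le> 2 * B * 0"
    by (intro LIMSEQ_le_const) auto
  then show ?thesis using x by auto
qed

text \<open>
  The fixed points of some of the maps form a compact convex set that the remaining maps preserve,
  since they commute with the former; so finitely many maps have a common fixed point, by adding
  one map at a time. Compactness extends this to arbitrary families.
\<close>

theorem markov_kakutani:
  fixes K :: "'a::real_normed_vector set"
  assumes X: "Hausdorff_space X"
    and K: "compactin X K" "K \<noteq> {}" "bounded K"
    and mid: "\<And>x y. x \<in> K \<Longrightarrow> y \<in> K \<Longrightarrow> midpoint x y \<in> K"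
    and maps: "\<And>f. f \<in> \<Phi> \<Longrightarrow> f ` K \<subseteq> K"
    and affine: "\<And>f x y. f \<in> \<Phi> \<Longrightarrow> x \<in> K \<Longrightarrow> y \<in> K \<Longrightarrow> f (midpoint x y) = midpoint (f x) (f y)"
    and commute: "\<And>f g x. f \<in> \<Phi> \<Longrightarrow> g \<in> \<Phi> \<Longrightarrow> x \<in> K \<Longrightarrow> f (g x) = g (f x)"
    and lsc: "\<And>f c. f \<in> \<Phi> \<Longrightarrow> closedin X {x \<in> K. norm (f x - x) \<le> c}"
  shows "\<exists>x\<in>K. \<forall>f\<in>\<Phi>. f x = x"
proof -
  define Fix where "Fix f = {x \<in> K. f x = x}" for f
  have closed: "closedin X (Fix f)" if "f \<in> \<Phi>" for f
    using lsc[OF that, of 0] by (simp add: Fix_def)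
  have finite: "compactin X (K \<inter> \<Inter>(Fix ` I)) \<and> K \<inter> \<Inter>(Fix ` I) \<noteq> {}" if "finite I" "I \<subseteq> \<Phi>" for I
    using that
  proof (induction I)
    case empty
    then show ?case using K by simp
  next
    case (insert f I)
    let ?L = "K \<inter> \<Inter>(Fix ` I)"
    have f: "f \<in> \<Phi>" and L: "compactin X ?L" "?L \<noteq> {}" using insert by auto
    have "\<exists>x\<in>?L. f x = x"
    proof (rule affine_fixed_point[OF L])
      show "bounded ?L" using K(3) by (rule bounded_subset) blast
      show "midpoint x y \<in> ?L" if "x \<in> ?L" "y \<in> ?L" for x y
      proof -
        have "g (midpoint x y) = midpoint x y" if "g \<in> I" for g
        proof -
          have "g \<in> \<Phi>" "g x = x" "g y = y"
            using that insert.prems \<open>x \<in> ?L\<close> \<open>y \<in> ?L\<close> by (auto simp: Fix_def)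
          then show ?thesis using affine[of g x y] \<open>x \<in> ?L\<close> \<open>y \<in> ?L\<close> by auto
        qed
        then show ?thesis using that mid[of x y] by (auto simp: Fix_def)
      qed
      show "f ` ?L \<subseteq> ?L"
      proof (rule image_subsetI)
        fix x assume x: "x \<in> ?L"
        have "g (f x) = f x" if "g \<in> I" for g
        proof -
          have "g \<in> \<Phi>" "g x = x" "x \<in> K" using that x insert.prems by (auto simp: Fix_def)
          then show ?thesis using commute[of g f x] f by simp
        qed
        then show "f x \<in> ?L" using x maps[OF f] by (auto simp: Fix_def)
      qed
      show "f (midpoint x y) = midpoint (f x) (f y)" if "x \<in> ?L" "y \<in> ?L" for x y
        using that affine[OF f, of x y] by simp
      show "closedin X {x \<in> ?L. norm (f x - x) \<le> c}" for c
      proof -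
        have "{x \<in> ?L. norm (f x - x) \<le> c} = ?L \<inter> {x \<in> K. norm (f x - x) \<le> c}" by auto
        then show ?thesis
          using compactin_imp_closedin[OF X L(1)] lsc[OF f, of c] by (simp add: closedin_Int)
      qed
    qed
    then have ne: "K \<inter> \<Inter>(Fix ` insert f I) \<noteq> {}" by (auto simp: Fix_def)
    have "K \<inter> \<Inter>(Fix ` insert f I) = Fix f \<inter> ?L" by auto
    with ne show ?case using closed_Int_compactin[OF closed[OF f] L(1)] by metis
  qed
  have "K \<inter> \<Inter>(Fix ` \<Phi>) \<noteq> {}"
  proof -
    have "K \<inter> \<Inter>\<F> \<noteq> {}" if "finite \<F>" "\<F> \<subseteq> Fix ` \<Phi>" for \<F>
      using finite_subset_image[OF that] finite by metis
    then show ?thesis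
      using K(1) closed unfolding compactin_fip by auto
  qed
  then show ?thesis by (auto simp: Fix_def)
qed

section \<open>Compactness of balls of operators\<close>

lemma compactin_pullback_topology:
  assumes "K \<subseteq> S" and K: "compactin X (f ` K)"
  shows "compactin (pullback_topology S f X) K"
  unfolding compactin_def
proof (intro conjI allI impI)
  show "K \<subseteq> topspace (pullback_topology S f X)"
    using assms compactin_subset_topspace[OF K] by (auto simp: topspace_pullback_topology)
next
  fix \<U> assume \<U>: "Ball \<U> (openin (pullback_topology S f X)) \<and> K \<subseteq> \<Union>\<U>"
  define \<V> where "\<V> = {V. openin X V \<and> f -` V \<inter> S \<in> \<U>}"
  have "f ` K \<subseteq> \<Union>\<V>"
  proof
    fix y assume "y \<in> f ` K"
    then obtain x where x: "x \<in> K" "y = f x" by blast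
    then obtain U where U: "U \<in> \<U>" "x \<in> U" using \<U> by blast
    then obtain V where "openin X V" "U = f -` V \<inter> S" using \<U> by (auto simp: openin_pullback_topology)
    then show "y \<in> \<Union>\<V>" using x U by (auto simp: \<V>_def)
  qed
  then obtain \<F> where \<F>: "finite \<F>" "\<F> \<subseteq> \<V>" "f ` K \<subseteq> \<Union>\<F>"
    using K unfolding compactin_def \<V>_def by (metis (no_types, lifting) mem_Collect_eq)
  show "\<exists>\<G>. finite \<G> \<and> \<G> \<subseteq> \<U> \<and> K \<subseteq> \<Union>\<G>"
  proof (intro exI conjI)
    show "finite ((\<lambda>V. f -` V \<inter> S) ` \<F>)" using \<F> by simp
    show "(\<lambda>V. f -` V \<inter> S) ` \<F> \<subseteq> \<U>" using \<F> by (auto simp: \<V>_def)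
    show "K \<subseteq> \<Union>((\<lambda>V. f -` V \<inter> S) ` \<F>)" using \<F>(3) \<open>K \<subseteq> S\<close> by blast
  qed
qed

text \<open>
  With the weak* topology as \<open>Y\<close> this is the weak* operator topology on \<open>S\<close>, and
  with scalar-valued operators and the usual topology it is the weak* topology of a dual space.
\<close>

definition pointwise_topology ::
  "('a::real_normed_vector \<Rightarrow>\<^sub>L 'b::real_normed_vector) set \<Rightarrow> 'b topology \<Rightarrow> ('a \<Rightarrow>\<^sub>L 'b) topology"
  where "pointwise_topology S Y =
    pullback_topology S blinfun_apply (product_topology (\<lambda>_. Y) UNIV)"

lemma topspace_pointwise_topology:
  "topspace (pointwise_topology S Y) = {P \<in> S. range (blinfun_apply P) \<subseteq> topspace Y}"
  by (auto simp: pointwise_topology_def topspace_pullback_topology PiE_UNIV_domain)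

lemma continuous_map_blinfun_apply:
  "continuous_map (pointwise_topology S Y) Y (\<lambda>P. blinfun_apply P x)"
  using continuous_map_pullback[OF continuous_map_product_projection[of x UNIV "\<lambda>_. Y"], of S blinfun_apply]
  by (simp add: pointwise_topology_def comp_def)

lemma continuous_map_into_pointwise_topology:
  assumes "\<And>z. z \<in> topspace Z \<Longrightarrow> f z \<in> S"
    and "\<And>x. continuous_map Z Y (\<lambda>z. blinfun_apply (f z) x)"
  shows "continuous_map Z (pointwise_topology S Y) f"
  unfolding pointwise_topology_def using assms
  by (intro continuous_map_pullback') (auto simp: continuous_map_componentwise_UNIV comp_def)

lemma Hausdorff_space_pointwise_topology:
  assumes "Hausdorff_space Y"
  shows "Hausdorff_space (pointwise_topology S Y)"
proof (rule Hausdorff_space_injective_preimage)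
  show "Hausdorff_space (product_topology (\<lambda>_. Y) UNIV)"
    using assms by (simp add: Hausdorff_space_product_topology)
  show "continuous_map (pointwise_topology S Y) (product_topology (\<lambda>_. Y) UNIV) blinfun_apply"
    by (simp add: continuous_map_componentwise_UNIV continuous_map_blinfun_apply)
qed (simp add: inj_on_def blinfun_apply_inject)

definition operators_into ::
  "('k \<Rightarrow> 'a::real_normed_vector \<Rightarrow> 'a) \<Rightarrow> ('k \<Rightarrow> 'b::real_normed_vector \<Rightarrow> 'b) \<Rightarrow> 'b set
    \<Rightarrow> ('a \<Rightarrow>\<^sub>L 'b) set"
  where "operators_into sa sb F = {P \<in> bounded_operators sa sb. range (blinfun_apply P) \<subseteq> F}"

text \<open>
  An operator of norm at most \<open>M\<close> is a point of the product of the balls \<open>F \<inter> cball 0 (M * norm x)\<close>,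
  which is compact by Tychonoff's theorem. The points of the product that come from operators are the
  linear ones, and linearity is a closed condition because it can be tested with a separating family
  of continuous linear functionals \<open>\<Lambda>\<close>. Real-linearity follows from linearity over the scalar field.
\<close>

theorem compactin_operator_ball:
  fixes sa :: "'k::real_normed_field \<Rightarrow> 'a::real_normed_vector \<Rightarrow> 'a"
    and sb :: "'k \<Rightarrow> 'b::real_normed_vector \<Rightarrow> 'b"
  assumes sa: "normed_space_over sa" and sb: "normed_space_over sb"
    and F: "module.subspace sb F"
    and compact: "\<And>r. compactin Y (F \<inter> cball 0 r)"
    and Hausdorff: "Hausdorff_space Y"
    and cont: "\<And>e. e \<in> \<Lambda> \<Longrightarrow> continuous_map Y euclidean e"
    and add: "\<And>e x y. e \<in> \<Lambda> \<Longrightarrow> x \<in> F \<Longrightarrow> y \<in> F \<Longrightarrow> e (x + y) = e x + e y"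
    and homog: "\<And>e c x. e \<in> \<Lambda> \<Longrightarrow> x \<in> F \<Longrightarrow> e (sb c x) = (c::'k) * e x"
    and separating: "\<And>x y. x \<in> F \<Longrightarrow> y \<in> F \<Longrightarrow> (\<And>e. e \<in> \<Lambda> \<Longrightarrow> e x = e y) \<Longrightarrow> x = y"
  shows "compactin (pointwise_topology (operators_into sa sb F) Y)
    (operators_into sa sb F \<inter> cball 0 M)"
proof (cases "0 \<le> M")
  case False
  then show ?thesis by simp
next
  case True
  interpret a: normed_space_over sa by fact
  interpret b: normed_space_over sb by fact
  let ?B = "operators_into sa sb F \<inter> cball 0 M"
  let ?P = "product_topology (\<lambda>_::'a. Y) UNIV"
  let ?K = "PiE UNIV (\<lambda>x::'a. F \<inter> cball 0 (M * norm x))"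
  define C where "C = topspace ?P \<inter>
    (\<Inter>e\<in>\<Lambda>. \<Inter>x. (\<Inter>y. {u \<in> topspace ?P. e (u (x + y)) = e (u x) + e (u y)}) \<inter>
      (\<Inter>c. {u \<in> topspace ?P. e (u (sa c x)) = c * e (u x)}))"
  have coord: "continuous_map ?P euclidean (\<lambda>u. e (u x))" if "e \<in> \<Lambda>" for e x
    using continuous_map_compose[OF continuous_map_product_projection[of x UNIV "\<lambda>_. Y"] cont[OF that]]
    by (simp add: comp_def)
  have "closedin ?P C"
  proof -
    have "closedin ?P {u \<in> topspace ?P. e (u (x + y)) = e (u x) + e (u y)}" if "e \<in> \<Lambda>" for e x y
      by (rule closedin_continuous_maps_eq[of euclidean]) (auto intro!: continuous_map_add coord that)
    moreover have "closedin ?P {u \<in> topspace ?P. e (u (sa c x)) = c * e (u x)}" if "e \<in> \<Lambda>" for e x c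
    proof (rule closedin_continuous_maps_eq[of euclidean])
      show "continuous_map ?P euclidean (\<lambda>u. c * e (u x))"
        using continuous_map_compose[OF coord[OF that, of x], of euclidean "\<lambda>z. c * z"]
        by (simp add: comp_def continuous_map_iff_continuous2 continuous_intros)
    qed (auto intro!: coord that)
    ultimately show ?thesis
      using closedin_topspace[of ?P]
      unfolding C_def by (cases "\<Lambda> = {}") (auto intro!: closedin_Int closedin_INT)
  qed
  moreover have "compactin ?P ?K" by (simp add: compactin_PiE compact)
  ultimately have "compactin ?P (C \<inter> ?K)" by (rule closed_Int_compactin)
  \<comment> \<open>The bound \<open>norm (u x) \<le> M * norm x\<close> is already part of the product of balls.\<close>
  moreover have "blinfun_apply ` ?B = C \<inter> ?K"
  proof (intro equalityI subsetI)
    have FY: "F \<subseteq> topspace Y"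
      using compactin_subset_topspace[OF compact] by (fastforce simp: subset_iff)
    fix u assume "u \<in> blinfun_apply ` ?B"
    then obtain P where P: "u = blinfun_apply P" "P \<in> bounded_operators sa sb" "\<And>x. P x \<in> F" "norm P \<le> M"
      by (force simp: operators_into_def)
    have "norm (P x) \<le> M * norm x" for x
      using norm_blinfun[of P x] mult_right_mono[OF P(4), of "norm x"] by simp
    then show "u \<in> C \<inter> ?K"
      using P FY by (auto simp: C_def bounded_operators_def PiE_UNIV_domain blinfun.add_right add homog)
  next
    fix u assume u: "u \<in> C \<inter> ?K"
    then have uF: "u x \<in> F" and norm_u: "norm (u x) \<le> M * norm x" for x by (auto simp: PiE_UNIV_domain)
    have "u (x + y) = u x + u y" for x y
      using u by (intro separating) (auto simp: C_def uF add b.subspace_add[OF F])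
    moreover have scale: "u (sa c x) = sb c (u x)" for c x
      using u by (intro separating) (auto simp: C_def uF homog b.subspace_scale[OF F])
    moreover have "u (r *\<^sub>R x) = r *\<^sub>R u x" for r x
      using scale[of "of_real r" x] by (simp add: a.scale_of_real b.scale_of_real)
    ultimately have "bounded_linear u"
      using norm_u by (intro bounded_linear_intro[of _ M]) (auto simp: mult.commute)
    then have u_apply: "blinfun_apply (Blinfun u) = u" by (rule bounded_linear_Blinfun_apply)
    have "norm (Blinfun u) \<le> M" using True norm_u by (intro norm_blinfun_bound) (auto simp: u_apply)
    then have "Blinfun u \<in> ?B" using uF scale by (auto simp: operators_into_def bounded_operators_def u_apply)
    then show "u \<in> blinfun_apply ` ?B" using u_apply by (metis imageI)
  qed
  ultimately have "compactin ?P (blinfun_apply ` ?B)" by simp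
  then show ?thesis unfolding pointwise_topology_def by (intro compactin_pullback_topology) auto
qed

section \<open>The weak* topology of a dual subspace\<close>

text \<open>
  The Banach--Alaoglu theorem: balls of the scalar field are compact, and the identity is a
  separating functional there.
\<close>

lemma compactin_dual_ball:
  fixes s :: "'k::{real_normed_field,heine_borel} \<Rightarrow> 'g::real_normed_vector \<Rightarrow> 'g"
  assumes "normed_space_over s"
  shows "compactin (weak_star_dual s) (dual_space s \<inter> cball 0 r)"
proof -
  interpret k: normed_space_over "(*) :: 'k \<Rightarrow> 'k \<Rightarrow> 'k" by (rule normed_space_over_mult)
  have "compactin (pointwise_topology (operators_into s ((*) :: 'k \<Rightarrow> 'k \<Rightarrow> 'k) UNIV) euclidean)
      (operators_into s (*) UNIV \<inter> cball 0 r)"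
    by (rule compactin_operator_ball[where \<Lambda> = "{id}"])
      (use assms normed_space_over_mult in \<open>auto simp: id_def\<close>)
  then show ?thesis
    by (simp add: operators_into_def dual_space_def weak_star_dual_def pointwise_topology_def)
qed

locale dual_subspace = E: normed_space_over sE + G: normed_space_over sG
  for sE :: "'k::{real_normed_field,heine_borel} \<Rightarrow> 'e::real_normed_vector \<Rightarrow> 'e"
    and sG :: "'k \<Rightarrow> 'g::real_normed_vector \<Rightarrow> 'g" +
  fixes F :: "'e set" and J :: "'e \<Rightarrow> ('g \<Rightarrow>\<^sub>L 'k)"
  assumes subspace: "module.subspace sE F"
    and dual: "isometric_isomorphism_onto_dual sE F sG J"
begin

abbreviation weak_star :: "'e topology" where "weak_star \<equiv> weak_star_on F sG J"

abbreviation ops :: "('e \<Rightarrow>\<^sub>L 'e) set" where "ops \<equiv> operators_into sE sE F"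

abbreviation op_topology :: "('e \<Rightarrow>\<^sub>L 'e) topology" where
  "op_topology \<equiv> pointwise_topology ops weak_star"

lemma J_add: "x \<in> F \<Longrightarrow> y \<in> F \<Longrightarrow> J (x + y) = J x + J y"
  and J_scale: "x \<in> F \<Longrightarrow> J (sE c x) g = c * J x g"
  and norm_J: "x \<in> F \<Longrightarrow> norm (J x) = norm x"
  and J_bij: "bij_betw J F (dual_space sG)"
  using dual by (auto simp: isometric_isomorphism_onto_dual_def)

lemma J_inject: "x \<in> F \<Longrightarrow> y \<in> F \<Longrightarrow> J x = J y \<longleftrightarrow> x = y"
  using J_bij by (auto simp: bij_betw_def inj_on_def)

lemma J_diff:
  assumes "x \<in> F" "y \<in> F"
  shows "J (x - y) = J x - J y"
  using J_add[of "x - y" y] E.subspace_diff[OF subspace assms] assms by (simp add: eq_diff_eq)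

lemma scaleR_in: "x \<in> F \<Longrightarrow> r *\<^sub>R x \<in> F"
  using E.subspace_scale[OF subspace, of x "of_real r"] by (simp add: E.scale_of_real)

lemma J_scaleR: "x \<in> F \<Longrightarrow> J (r *\<^sub>R x) g = r *\<^sub>R J x g"
  using J_scale[of x "of_real r" g] by (simp add: E.scale_of_real scaleR_conv_of_real)

lemma topspace_weak_star: "topspace weak_star = F"
  using J_bij
  by (auto simp: weak_star_on_def weak_star_dual_def topspace_pullback_topology bij_betw_def PiE_UNIV_domain)

lemma continuous_map_eval: "continuous_map weak_star euclidean (\<lambda>x. J x g)"
  using continuous_map_pullback[OF continuous_map_blinfun_apply[of "dual_space sG" euclidean g], of F J]
  by (simp add: weak_star_on_def weak_star_dual_def pointwise_topology_def comp_def)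

lemma continuous_map_into_weak_star:
  assumes "\<And>z. z \<in> topspace Z \<Longrightarrow> f z \<in> F"
    and "\<And>g. continuous_map Z euclidean (\<lambda>z. J (f z) g)"
  shows "continuous_map Z weak_star f"
  unfolding weak_star_on_def
proof (rule continuous_map_pullback')
  show "continuous_map Z (weak_star_dual sG) (J \<circ> f)"
    unfolding weak_star_dual_def pointwise_topology_def[symmetric]
    using assms J_bij by (intro continuous_map_into_pointwise_topology) (auto simp: bij_betw_def)
qed (use assms in auto)

lemma Hausdorff_weak_star: "Hausdorff_space weak_star"
proof (rule Hausdorff_space_injective_preimage)
  show "Hausdorff_space (product_topology (\<lambda>_::'g. euclidean :: 'k topology) UNIV)"
    by (simp add: Hausdorff_space_product_topology)
  show "continuous_map weak_star (product_topology (\<lambda>_. euclidean) UNIV) (\<lambda>x. blinfun_apply (J x))"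
    by (simp add: continuous_map_componentwise_UNIV continuous_map_eval)
  show "inj_on (\<lambda>x. blinfun_apply (J x)) (topspace weak_star)"
    by (auto simp: topspace_weak_star inj_on_def blinfun_apply_inject J_inject)
qed

lemma compactin_ball: "compactin weak_star (F \<inter> cball 0 r)"
  unfolding weak_star_on_def
proof (rule compactin_pullback_topology)
  have "J ` (F \<inter> cball 0 r) = dual_space sG \<inter> cball 0 r"
  proof (intro equalityI subsetI)
    fix h assume "h \<in> dual_space sG \<inter> cball 0 r"
    moreover from this obtain x where "x \<in> F" "h = J x" using J_bij by (auto simp: bij_betw_def)
    ultimately show "h \<in> J ` (F \<inter> cball 0 r)" by (simp add: norm_J)
  qed (use J_bij in \<open>auto simp: bij_betw_def norm_J\<close>)
  then show "compactin (weak_star_dual sG) (J ` (F \<inter> cball 0 r))"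
    using compactin_dual_ball[OF G.normed_space_over_axioms] by simp
qed auto

lemma Hausdorff_op_topology: "Hausdorff_space op_topology"
  by (intro Hausdorff_space_pointwise_topology Hausdorff_weak_star)

lemma compactin_ops_ball: "compactin op_topology (ops \<inter> cball 0 M)"
proof (rule compactin_operator_ball[where \<Lambda> = "range (\<lambda>g x. J x g)"])
  show "x = y" if "x \<in> F" "y \<in> F" "\<And>e. e \<in> range (\<lambda>g x. blinfun_apply (J x) g) \<Longrightarrow> e x = e y" for x y
  proof -
    have "J x = J y" using that(3) by (intro blinfun_eqI) auto
    then show ?thesis using that by (simp add: J_inject)
  qed
qed (auto simp: E.normed_space_over_axioms subspace compactin_ball Hausdorff_weak_star
    continuous_map_eval J_add J_scale blinfun.add_left)

lemma closedin_ops_ball: "closedin op_topology (ops \<inter> cball 0 M)"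
  by (intro compactin_imp_closedin Hausdorff_op_topology compactin_ops_ball)

text \<open>
  Lower semicontinuity of the operator norm: the norm of an operator into \<open>F\<close> is the supremum of
  its evaluations at unit vectors of \<open>E\<close> and of the predual, and these are continuous. The
  difference of two maps covers both the displacement of an operator under conjugation and, with
  \<open>\<psi>\<close> zero, the norm of a conjugate.
\<close>

lemma closedin_norm_diff_le:
  assumes \<phi>: "continuous_map Z op_topology \<phi>" and \<psi>: "continuous_map Z op_topology \<psi>"
  shows "closedin Z {z \<in> topspace Z. norm (\<phi> z - \<psi> z) \<le> c}"
proof (cases "0 \<le> c")
  case False
  then have "\<And>x::'e \<Rightarrow>\<^sub>L 'e. \<not> norm x \<le> c" using norm_ge_zero order_trans by blast
  then show ?thesis by simp
next
  case True
  have in_F: "\<phi> z x \<in> F" "\<psi> z x \<in> F" if "z \<in> topspace Z" for z x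
    using that continuous_map_image_subset_topspace[OF \<phi>] continuous_map_image_subset_topspace[OF \<psi>]
    by (auto simp: topspace_pointwise_topology topspace_weak_star image_subset_iff)
  have eval: "continuous_map Z euclidean (\<lambda>z. J (\<theta> z x) g)" if "continuous_map Z op_topology \<theta>" for \<theta> x g
    using continuous_map_compose[OF continuous_map_compose[OF that continuous_map_blinfun_apply] continuous_map_eval]
    by (simp add: comp_def)
  let ?C = "\<lambda>x g. {z \<in> topspace Z. norm (J (\<phi> z x) g - J (\<psi> z x) g) \<in> {..c * norm x * norm g}}"
  have "closedin Z (?C x g)" for x g
    by (rule closedin_continuous_map_preimage[where Y = euclidean])
      (auto intro!: continuous_map_norm continuous_map_diff eval \<phi> \<psi>)
  then have "closedin Z (\<Inter>x g. ?C x g)" by (intro closedin_INT) auto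
  moreover have "(\<Inter>x g. ?C x g) = {z \<in> topspace Z. norm (\<phi> z - \<psi> z) \<le> c}"
  proof -
    have "(\<forall>x g. norm (J (\<phi> z x) g - J (\<psi> z x) g) \<le> c * norm x * norm g) \<longleftrightarrow> norm (\<phi> z - \<psi> z) \<le> c"
      if z: "z \<in> topspace Z" for z
    proof -
      have J: "J (\<phi> z x) g - J (\<psi> z x) g = J ((\<phi> z - \<psi> z) x) g" for x g
        by (simp add: blinfun.diff_left J_diff in_F[OF z])
      have norm: "norm (J ((\<phi> z - \<psi> z) x)) = norm ((\<phi> z - \<psi> z) x)" for x
        by (simp add: norm_J blinfun.diff_left E.subspace_diff[OF subspace] in_F[OF z])
      show ?thesis unfolding J
      proof
        assume *: "\<forall>x g. norm (J ((\<phi> z - \<psi> z) x) g) \<le> c * norm x * norm g"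
        have "norm ((\<phi> z - \<psi> z) x) \<le> c * norm x" for x
          unfolding norm[symmetric] using * True by (intro norm_blinfun_bound) auto
        then show "norm (\<phi> z - \<psi> z) \<le> c" using True by (intro norm_blinfun_bound) auto
      next
        assume *: "norm (\<phi> z - \<psi> z) \<le> c"
        show "\<forall>x g. norm (J ((\<phi> z - \<psi> z) x) g) \<le> c * norm x * norm g"
        proof (intro allI)
          fix x g
          have "norm (J ((\<phi> z - \<psi> z) x) g) \<le> norm ((\<phi> z - \<psi> z) x) * norm g"
            using norm_blinfun[of "J ((\<phi> z - \<psi> z) x)" g] by (simp only: norm)
          also have "\<dots> \<le> norm (\<phi> z - \<psi> z) * norm x * norm g"
            by (intro mult_right_mono norm_blinfun) auto
          also have "\<dots> \<le> c * norm x * norm g"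
            by (intro mult_right_mono *) auto
          finally show "norm (J ((\<phi> z - \<psi> z) x) g) \<le> c * norm x * norm g" .
        qed
      qed
    qed
    then show ?thesis by auto
  qed
  ultimately show ?thesis by simp
qed

lemma ops_in: "P \<in> ops \<Longrightarrow> P x \<in> F"
  by (auto simp: operators_into_def)

lemma midpoint_in_ops:
  assumes "P \<in> ops" "Q \<in> ops"
  shows "midpoint P Q \<in> ops"
proof -
  have half: "(1/2) *\<^sub>R sE c x = sE c ((1/2) *\<^sub>R x)" for c x
    unfolding E.scale_of_real[symmetric] by (rule E.scale_left_commute)
  show ?thesis
    using assms E.subspace_add[OF subspace] scaleR_in
    by (auto simp: midpoint_def operators_into_def bounded_operators_def blinfun.add_left blinfun.scaleR_left
        image_subset_iff half simp flip: E.scale_right_distrib)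
qed

lemma topspace_op_topology: "topspace op_topology = ops"
  by (auto simp: topspace_pointwise_topology topspace_weak_star operators_into_def)

lemma zero_in_ops: "0 \<in> ops"
  using E.subspace_0[OF subspace] by (auto simp: operators_into_def bounded_operators_def)

lemma projection_onto_iff: "projection_onto sE F P \<longleftrightarrow> P \<in> ops \<and> (\<forall>f\<in>F. P f = f)"
  by (auto simp: projection_onto_def operators_into_def)

lemma closedin_projections: "closedin op_topology {P \<in> ops. \<forall>f\<in>F. P f = f}"
proof -
  have "closedin op_topology {P \<in> topspace op_topology. P f = f}" if "f \<in> F" for f
    using that by (intro closedin_continuous_maps_eq[OF Hausdorff_weak_star])
      (auto simp: continuous_map_blinfun_apply topspace_weak_star)
  then have "closedin op_topology (topspace op_topology \<inter> (\<Inter>f\<in>F. {P \<in> topspace op_topology. P f = f}))"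
    using E.subspace_0[OF subspace] by (intro closedin_Int closedin_INT) auto
  then show ?thesis unfolding topspace_op_topology by (elim back_subst[of "closedin op_topology"]) auto
qed

end

section \<open>Conjugation by an isomorphism of the subspace\<close>

text \<open>
  The operator \<open>(T|\<^sub>F)\<^sup>-\<^sup>1 P T\<close>; it is bounded and linear when \<open>T|\<^sub>F\<close> is an isomorphism and \<open>P\<close> has
  its range in \<open>F\<close>.
\<close>

definition conjugate :: "'e set \<Rightarrow> ('e \<Rightarrow>\<^sub>L 'e) \<Rightarrow> ('e \<Rightarrow>\<^sub>L 'e) \<Rightarrow> ('e::real_normed_vector \<Rightarrow>\<^sub>L 'e)" where
  "conjugate F T P = Blinfun (\<lambda>x. inv_into F (blinfun_apply T) (P (T x)))"

locale dual_subspace_isomorphism = dual_subspace sE sG F J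
  for sE :: "'k::{real_normed_field,heine_borel} \<Rightarrow> 'e::real_normed_vector \<Rightarrow> 'e"
    and sG :: "'k \<Rightarrow> 'g::real_normed_vector \<Rightarrow> 'g" and F J +
  fixes T :: "'e \<Rightarrow>\<^sub>L 'e"
  assumes T: "T \<in> bounded_operators sE sE"
    and iso: "isomorphism_on sE F (blinfun_apply T)"
    and weak_star_cont: "continuous_map (subtopology weak_star (F \<inter> cball 0 1)) weak_star (blinfun_apply T)"
begin

abbreviation T_inv :: "'e \<Rightarrow> 'e" where "T_inv \<equiv> inv_into F (blinfun_apply T)"

lemma T_bij: "bij_betw (blinfun_apply T) F F"
  and T_inv_bounded: "bounded_operator_on sE F T_inv"
  using iso by (auto simp: isomorphism_on_def)

lemma T_in: "x \<in> F \<Longrightarrow> T x \<in> F"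
  and T_inv_in: "y \<in> F \<Longrightarrow> T_inv y \<in> F"
  and T_T_inv: "y \<in> F \<Longrightarrow> T (T_inv y) = y"
  and T_inv_T: "x \<in> F \<Longrightarrow> T_inv (T x) = x"
  using T_bij by (auto simp: bij_betw_def f_inv_into_f inv_into_into)

lemma T_inv_add: "x \<in> F \<Longrightarrow> y \<in> F \<Longrightarrow> T_inv (x + y) = T_inv x + T_inv y"
  and T_inv_scale: "x \<in> F \<Longrightarrow> T_inv (sE c x) = sE c (T_inv x)"
  using T_inv_bounded by (auto simp: bounded_operator_on_def)

lemma T_inv_scaleR: "x \<in> F \<Longrightarrow> T_inv (r *\<^sub>R x) = r *\<^sub>R T_inv x"
  using T_inv_scale[of x "of_real r"] by (simp add: E.scale_of_real)

lemma bdd_above_T_inv: "bdd_above ((\<lambda>y. norm (T_inv y) / norm y) ` F)"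
proof -
  obtain K where K: "\<And>y. y \<in> F \<Longrightarrow> norm (T_inv y) \<le> norm y * K"
    using T_inv_bounded unfolding bounded_operator_on_def by blast
  have "norm (T_inv y) / norm y \<le> max K 0" if "y \<in> F" for y
    using K[OF that] by (cases "y = 0") (auto simp: divide_simps mult.commute le_max_iff_disj)
  then show ?thesis by (intro bdd_aboveI2)
qed

lemma norm_T_inv: "y \<in> F \<Longrightarrow> norm (T_inv y) \<le> onorm_on F T_inv * norm y"
proof -
  assume y: "y \<in> F"
  have "norm (T_inv y) / norm y \<le> onorm_on F T_inv"
    unfolding onorm_on_def by (rule cSUP_upper[OF y bdd_above_T_inv])
  moreover have "T_inv 0 = 0" using T_inv_scaleR[of 0 0] E.subspace_0[OF subspace] by simp
  ultimately show ?thesis by (cases "y = 0") (auto simp: divide_simps)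
qed

lemma onorm_T_inv_nonneg: "0 \<le> onorm_on F T_inv"
proof -
  have "norm (T_inv 0) / norm (0::'e) \<le> onorm_on F T_inv"
    unfolding onorm_on_def by (rule cSUP_upper[OF E.subspace_0[OF subspace] bdd_above_T_inv])
  then show ?thesis by simp
qed

text \<open>
  Continuity on the unit ball is transported to larger balls by a dilation, which is weak*
  continuous in both directions.
\<close>

lemma weak_star_continuous_on_ball:
  assumes "0 < R"
  shows "continuous_map (subtopology weak_star (F \<inter> cball 0 R)) weak_star (blinfun_apply T)"
proof (rule continuous_map_into_weak_star)
  let ?Z = "subtopology weak_star (F \<inter> cball 0 R)"
  show "T z \<in> F" if "z \<in> topspace ?Z" for z
    using that by (simp add: topspace_weak_star T_in)
  fix g
  have "continuous_map ?Z weak_star (\<lambda>z. (1/R) *\<^sub>R z)"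
  proof (rule continuous_map_into_weak_star)
    fix g
    have "continuous_map ?Z euclidean (\<lambda>z. (1/R) *\<^sub>R J z g)"
      using continuous_map_compose[OF continuous_map_from_subtopology[OF continuous_map_eval[of g]],
          of euclidean "\<lambda>c. (1/R) *\<^sub>R c"]
      by (simp add: comp_def continuous_map_iff_continuous2 continuous_intros)
    then show "continuous_map ?Z euclidean (\<lambda>z. J ((1/R) *\<^sub>R z) g)"
      by (rule continuous_map_eq) (simp add: topspace_weak_star J_scaleR)
  qed (simp add: topspace_weak_star scaleR_in)
  then have "continuous_map ?Z (subtopology weak_star (F \<inter> cball 0 1)) (\<lambda>z. (1/R) *\<^sub>R z)"
    using assms by (auto simp: continuous_map_in_subtopology topspace_weak_star scaleR_in divide_simps)
  from continuous_map_compose[OF continuous_map_compose[OF this weak_star_cont] continuous_map_eval[of g]]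
  have "continuous_map ?Z euclidean (\<lambda>z. J (T ((1/R) *\<^sub>R z)) g)" by (simp add: comp_def)
  from continuous_map_compose[OF this, of euclidean "\<lambda>c. R *\<^sub>R c"]
  have "continuous_map ?Z euclidean (\<lambda>z. R *\<^sub>R J (T ((1/R) *\<^sub>R z)) g)"
    by (simp add: comp_def continuous_map_iff_continuous2 continuous_intros)
  then show "continuous_map ?Z euclidean (\<lambda>z. J (T z) g)"
  proof (rule continuous_map_eq)
    fix z assume "z \<in> topspace ?Z"
    then have "T z \<in> F" by (simp add: topspace_weak_star T_in)
    then show "R *\<^sub>R J (T ((1/R) *\<^sub>R z)) g = J (T z) g"
      using assms by (simp add: blinfun.scaleR_right J_scaleR)
  qed
qed

text \<open>
  The radius \<open>R\<close> is chosen so that \<open>T\<close> maps the compact ball of radius \<open>R\<close> onto a superset of the ball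
  of radius \<open>r\<close>; a continuous injection of a compact space into a Hausdorff space has a continuous
  inverse on its image.
\<close>

lemma weak_star_continuous_inverse:
  "continuous_map (subtopology weak_star (F \<inter> cball 0 r)) weak_star T_inv"
proof -
  define R where "R = max 1 (onorm_on F T_inv * r)"
  let ?Z = "subtopology weak_star (F \<inter> cball 0 R)"
  have "continuous_map (subtopology weak_star (F \<inter> cball 0 r)) ?Z T_inv"
  proof (rule continuous_inverse_map)
    show "compact_space ?Z" by (intro compact_space_subtopology compactin_ball)
    show "continuous_map ?Z weak_star (blinfun_apply T)"
      by (rule weak_star_continuous_on_ball) (simp add: R_def)
    show "F \<inter> cball 0 r \<subseteq> blinfun_apply T ` topspace ?Z"
    proof
      fix y assume y: "y \<in> F \<inter> cball 0 r"
      have "norm (T_inv y) \<le> onorm_on F T_inv * norm y" using y by (intro norm_T_inv) auto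
      also have "\<dots> \<le> onorm_on F T_inv * r"
        using y by (intro mult_left_mono onorm_T_inv_nonneg) auto
      finally have "T_inv y \<in> topspace ?Z"
        using y by (simp add: topspace_weak_star T_inv_in R_def)
      then show "y \<in> blinfun_apply T ` topspace ?Z"
        using y T_T_inv[of y] by (metis IntD1 imageI)
    qed
  qed (auto simp: topspace_weak_star T_inv_T Hausdorff_weak_star)
  then show ?thesis by (simp add: continuous_map_in_subtopology)
qed

lemma norm_conjugate_apply:
  assumes "P \<in> ops"
  shows "norm (T_inv (P (T x))) \<le> norm T * onorm_on F T_inv * norm P * norm x"
proof -
  have "norm (T_inv (P (T x))) \<le> onorm_on F T_inv * norm (P (T x))"
    by (rule norm_T_inv[OF ops_in[OF assms]])
  also have "\<dots> \<le> onorm_on F T_inv * (norm P * norm (T x))"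
    by (intro mult_left_mono norm_blinfun onorm_T_inv_nonneg)
  also have "\<dots> \<le> onorm_on F T_inv * (norm P * (norm T * norm x))"
    by (intro mult_left_mono norm_blinfun onorm_T_inv_nonneg norm_ge_zero)
  finally show ?thesis using onorm_T_inv_nonneg by (simp add: mult_ac)
qed

lemma conjugate_apply:
  assumes "P \<in> ops"
  shows "conjugate F T P x = T_inv (P (T x))"
proof -
  have "bounded_linear (\<lambda>x. T_inv (P (T x)))"
    by (rule bounded_linear_intro[of _ "norm T * onorm_on F T_inv * norm P"])
      (use norm_conjugate_apply[OF assms] in \<open>simp_all add: blinfun.add_right blinfun.scaleR_right T_inv_add
        T_inv_scaleR ops_in[OF assms] mult_ac\<close>)
  then show ?thesis by (simp add: conjugate_def bounded_linear_Blinfun_apply)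
qed

lemma conjugate_in_ops:
  assumes "P \<in> ops"
  shows "conjugate F T P \<in> ops"
  using assms T ops_in[OF assms]
  by (auto simp: operators_into_def bounded_operators_def conjugate_apply[OF assms] T_inv_in T_inv_scale)

lemma norm_conjugate:
  assumes "P \<in> ops"
  shows "norm (conjugate F T P) \<le> norm T * onorm_on F T_inv * norm P"
  using norm_conjugate_apply[OF assms] onorm_T_inv_nonneg
  by (intro norm_blinfun_bound) (auto simp: conjugate_apply[OF assms])

lemma conjugate_fixes: "P \<in> ops \<Longrightarrow> (\<forall>f\<in>F. P f = f) \<Longrightarrow> f \<in> F \<Longrightarrow> conjugate F T P f = f"
  by (simp add: conjugate_apply T_in T_inv_T)

lemma conjugate_eq_iff_commutes:
  assumes "P \<in> ops"
  shows "conjugate F T P = P \<longleftrightarrow> P o\<^sub>L T = T o\<^sub>L P"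
proof -
  have "T_inv (P (T x)) = P x \<longleftrightarrow> P (T x) = T (P x)" for x
    using T_T_inv T_inv_T ops_in[OF assms] by metis
  then show ?thesis
    by (metis (no_types) blinfun_eqI blinfun_apply_blinfun_compose conjugate_apply[OF assms])
qed

lemma conjugate_midpoint:
  assumes "P \<in> ops" "Q \<in> ops"
  shows "conjugate F T (midpoint P Q) = midpoint (conjugate F T P) (conjugate F T Q)"
proof (rule blinfun_eqI)
  fix x
  have "P (T x) \<in> F" "Q (T x) \<in> F" using assms by (auto intro: ops_in)
  then have "T_inv ((1/2) *\<^sub>R (P (T x) + Q (T x))) = (1/2) *\<^sub>R (T_inv (P (T x)) + T_inv (Q (T x)))"
    by (simp add: T_inv_scaleR T_inv_add E.subspace_add[OF subspace])
  then show "conjugate F T (midpoint P Q) x = midpoint (conjugate F T P) (conjugate F T Q) x"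
    unfolding conjugate_apply[OF midpoint_in_ops[OF assms]]
    by (simp add: midpoint_def blinfun.add_left blinfun.scaleR_left conjugate_apply assms)
qed

text \<open>
  Restricting to a ball of operators keeps the values \<open>P (T x)\<close> in a fixed ball of \<open>F\<close>, where the
  inverse of \<open>T|\<^sub>F\<close> is weak* continuous.
\<close>

lemma continuous_map_conjugate:
  "continuous_map (subtopology op_topology (ops \<inter> cball 0 M)) op_topology (conjugate F T)"
proof (rule continuous_map_into_pointwise_topology)
  let ?Z = "subtopology op_topology (ops \<inter> cball 0 M)"
  show "conjugate F T P \<in> ops" if "P \<in> topspace ?Z" for P
    using that by (simp add: conjugate_in_ops)
  fix x
  let ?B = "F \<inter> cball 0 (M * norm (T x))"
  have "continuous_map ?Z (subtopology weak_star ?B) (\<lambda>P. P (T x))"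
  proof -
    have "norm (P (T x)) \<le> M * norm (T x)" if "norm P \<le> M" for P :: "'e \<Rightarrow>\<^sub>L 'e"
      using norm_blinfun[of P "T x"] mult_right_mono[OF that, of "norm (T x)"] by simp
    then show ?thesis
      by (auto simp: continuous_map_in_subtopology ops_in
          intro: continuous_map_from_subtopology continuous_map_blinfun_apply)
  qed
  from continuous_map_compose[OF this weak_star_continuous_inverse]
  show "continuous_map ?Z weak_star (\<lambda>P. conjugate F T P x)"
    by (rule continuous_map_eq) (simp add: conjugate_apply)
qed

end

section \<open>Projections commuting with the semigroup\<close>

locale dual_subspace_semigroup = dual_subspace sE sG F J
  for sE :: "'k::{real_normed_field,heine_borel} \<Rightarrow> 'e::real_normed_vector \<Rightarrow> 'e"
    and sG :: "'k \<Rightarrow> 'g::real_normed_vector \<Rightarrow> 'g" and F J +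
  fixes \<T> :: "('e \<Rightarrow>\<^sub>L 'e) set"
  assumes semigroup: "abelian_operator_semigroup sE \<T>"
    and isomorphism: "T \<in> \<T> \<Longrightarrow> dual_subspace_isomorphism sE sG F J T"
    and bounded: "bdd_above ((\<lambda>T. norm T * onorm_on F (inv_into F (blinfun_apply T))) ` \<T>)"
begin

abbreviation bound :: real where
  "bound \<equiv> SUP T\<in>\<T>. norm T * onorm_on F (inv_into F (blinfun_apply T))"

lemma bound_nonneg: "0 \<le> bound"
proof -
  obtain T where T: "T \<in> \<T>" using semigroup by (auto simp: abelian_operator_semigroup_def)
  have "0 \<le> norm T * onorm_on F (inv_into F (blinfun_apply T))"
    by (intro mult_nonneg_nonneg norm_ge_zero dual_subspace_isomorphism.onorm_T_inv_nonneg[OF isomorphism[OF T]])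
  also have "\<dots> \<le> bound" by (rule cSUP_upper[OF T bounded])
  finally show ?thesis .
qed

lemma conjugate_le_bound:
  assumes "T \<in> \<T>" "P \<in> ops"
  shows "norm (conjugate F T P) \<le> bound * norm P"
  using dual_subspace_isomorphism.norm_conjugate[OF isomorphism[OF assms(1)] assms(2)]
    mult_right_mono[OF cSUP_upper[OF assms(1) bounded] norm_ge_zero[of P]]
  by linarith

text \<open>
  Conjugation reverses the order of composition, which is immaterial in an abelian semigroup.
\<close>

lemma conjugate_compose:
  assumes S: "S \<in> \<T>" and T: "T \<in> \<T>" and P: "P \<in> ops"
  shows "conjugate F S (conjugate F T P) = conjugate F (S o\<^sub>L T) P"
proof (rule blinfun_eqI)
  fix x
  interpret S: dual_subspace_isomorphism sE sG F J S by (rule isomorphism[OF S])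
  interpret T: dual_subspace_isomorphism sE sG F J T by (rule isomorphism[OF T])
  have ST: "S o\<^sub>L T \<in> \<T>" and comm: "S o\<^sub>L T = T o\<^sub>L S"
    using semigroup S T by (auto simp: abelian_operator_semigroup_def)
  interpret ST: dual_subspace_isomorphism sE sG F J "S o\<^sub>L T" by (rule isomorphism[OF ST])
  let ?y = "P (T (S x))"
  have y: "?y \<in> F" by (rule ops_in[OF P])
  have "S.T_inv (T.T_inv ?y) = ST.T_inv ?y"
  proof -
    have "blinfun_apply (S o\<^sub>L T) (S.T_inv (T.T_inv ?y)) = ?y"
      by (simp add: comm y S.T_T_inv T.T_T_inv T.T_inv_in)
    then show ?thesis
      using ST.T_inv_T[of "S.T_inv (T.T_inv ?y)"] by (simp add: y S.T_inv_in T.T_inv_in)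
  qed
  moreover have "blinfun_apply (S o\<^sub>L T) x = T (S x)" by (simp add: comm)
  ultimately show "conjugate F S (conjugate F T P) x = conjugate F (S o\<^sub>L T) P x"
    by (simp add: S.conjugate_apply T.conjugate_apply ST.conjugate_apply T.conjugate_in_ops P)
qed

lemma conjugate_commute:
  assumes "S \<in> \<T>" "T \<in> \<T>" "P \<in> ops"
  shows "conjugate F S (conjugate F T P) = conjugate F T (conjugate F S P)"
  using assms semigroup conjugate_compose[of S T P] conjugate_compose[of T S P]
  by (auto simp: abelian_operator_semigroup_def)

lemma commutes_with_all_iff:
  assumes "P \<in> ops"
  shows "commutes_with_all P \<T> \<longleftrightarrow> (\<forall>T\<in>\<T>. conjugate F T P = P)"
  using dual_subspace_isomorphism.conjugate_eq_iff_commutes[OF isomorphism assms]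
  by (auto simp: commutes_with_all_def)

lemma closedin_conjugate_diff_le:
  assumes "T \<in> \<T>"
  shows "closedin op_topology {P \<in> ops \<inter> cball 0 M. norm (conjugate F T P - P) \<le> c}"
proof -
  interpret T: dual_subspace_isomorphism sE sG F J T by (rule isomorphism[OF assms])
  let ?Z = "subtopology op_topology (ops \<inter> cball 0 M)"
  have "closedin ?Z {P \<in> topspace ?Z. norm (conjugate F T P - P) \<le> c}"
    by (intro closedin_norm_diff_le T.continuous_map_conjugate continuous_map_from_subtopology) simp
  moreover have "topspace ?Z = ops \<inter> cball 0 M" by (simp add: topspace_op_topology)
  ultimately show ?thesis using closedin_trans_full[OF _ closedin_ops_ball]
    by (simp add: topspace_op_topology)
qed

lemma closedin_conjugate_le:
  assumes "T \<in> \<T>"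
  shows "closedin op_topology {P \<in> ops \<inter> cball 0 M. norm (conjugate F T P) \<le> c}"
proof -
  interpret T: dual_subspace_isomorphism sE sG F J T by (rule isomorphism[OF assms])
  let ?Z = "subtopology op_topology (ops \<inter> cball 0 M)"
  have "closedin ?Z {P \<in> topspace ?Z. norm (conjugate F T P - 0) \<le> c}"
    by (intro closedin_norm_diff_le T.continuous_map_conjugate) (simp add: zero_in_ops topspace_op_topology)
  moreover have "topspace ?Z = ops \<inter> cball 0 M" by (simp add: topspace_op_topology)
  ultimately show ?thesis using closedin_trans_full[OF _ closedin_ops_ball]
    by (simp add: topspace_op_topology)
qed

text \<open>
  A bound on the norm alone would not be invariant, as each conjugation may enlarge norms by the
  factor \<open>bound\<close>. Bounding the norms of all conjugates at once is invariant, since the conjugates of a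
  conjugate are among the original conjugates.
\<close>

theorem commuting_projection_exists:
  assumes P: "projection_onto sE F P"
  shows "\<exists>Q. projection_onto sE F Q \<and> commutes_with_all Q \<T> \<and> norm Q \<le> bound * norm P"
proof -
  define c where "c = bound * norm P"
  \<comment> \<open>The radius is large enough for \<open>P\<close> and for all conjugates of elements of \<open>K\<close>.\<close>
  define M where "M = max (norm P) c"
  let ?B = "ops \<inter> cball 0 M"
  define K where "K = {Q \<in> ?B. (\<forall>f\<in>F. Q f = f) \<and> (\<forall>T\<in>\<T>. norm (conjugate F T Q) \<le> c)}"
  have "\<exists>Q\<in>K. \<forall>\<phi>\<in>conjugate F ` \<T>. \<phi> Q = Q"
  proof (rule markov_kakutani[OF Hausdorff_op_topology])
    have T0: "\<T> \<noteq> {}" using semigroup by (simp add: abelian_operator_semigroup_def)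
    have K_eq: "K = {Q \<in> ops. \<forall>f\<in>F. Q f = f} \<inter> (\<Inter>T\<in>\<T>. {Q \<in> ?B. norm (conjugate F T Q) \<le> c})"
      using T0 by (auto simp: K_def)
    have closed: "closedin op_topology K"
      unfolding K_eq by (intro closedin_Int closedin_INT closedin_projections closedin_conjugate_le T0)
    show "compactin op_topology K"
      by (rule closed_compactin[OF compactin_ops_ball[of M] _ closed]) (auto simp: K_def)
    have "P \<in> K"
      using P conjugate_le_bound by (auto simp: K_def projection_onto_iff M_def c_def)
    then show "K \<noteq> {}" by blast
    show "bounded K"
      by (rule bounded_subset[OF bounded_cball[of 0 M]]) (auto simp: K_def)
    show "midpoint Q R \<in> K" if "Q \<in> K" "R \<in> K" for Q R
    proof -
      have mid: "norm (midpoint U V) \<le> d" if "norm U \<le> d" "norm V \<le> d" for U V :: "'e \<Rightarrow>\<^sub>L 'e" and d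
        using norm_triangle_ineq[of U V] that by (simp add: midpoint_def)
      have "norm (conjugate F T (midpoint Q R)) \<le> c" if "T \<in> \<T>" for T
        using that \<open>Q \<in> K\<close> \<open>R \<in> K\<close> dual_subspace_isomorphism.conjugate_midpoint[OF isomorphism[OF that], of Q R]
        by (auto simp: K_def intro!: mid)
      moreover have "midpoint Q R f = f" if "f \<in> F" for f
        using that \<open>Q \<in> K\<close> \<open>R \<in> K\<close>
        by (simp add: K_def midpoint_def blinfun.add_left blinfun.scaleR_left flip: scaleR_2)
      ultimately show ?thesis
        using that by (auto simp: K_def midpoint_in_ops intro!: mid)
    qed
    fix \<phi> assume "\<phi> \<in> conjugate F ` \<T>"
    then obtain T where T: "T \<in> \<T>" "\<phi> = conjugate F T" by blast
    interpret T: dual_subspace_isomorphism sE sG F J T by (rule isomorphism[OF T(1)])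
    show "\<phi> ` K \<subseteq> K"
    proof (rule image_subsetI)
      fix Q assume Q: "Q \<in> K"
      have "norm (conjugate F S (conjugate F T Q)) \<le> c" if S: "S \<in> \<T>" for S
      proof -
        have "S o\<^sub>L T \<in> \<T>" using S T semigroup by (auto simp: abelian_operator_semigroup_def)
        then show ?thesis using Q S T by (auto simp: conjugate_compose K_def)
      qed
      then show "\<phi> Q \<in> K"
        using Q T by (auto simp: K_def T.conjugate_in_ops T.conjugate_fixes M_def le_max_iff_disj)
    qed
    show "\<phi> (midpoint Q R) = midpoint (\<phi> Q) (\<phi> R)" if "Q \<in> K" "R \<in> K" for Q R
      using that by (auto simp: T K_def T.conjugate_midpoint)
    show "\<phi> (\<psi> Q) = \<psi> (\<phi> Q)" if "\<psi> \<in> conjugate F ` \<T>" "Q \<in> K" for \<psi> Q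
      using that by (auto simp: T K_def intro: conjugate_commute)
    show "closedin op_topology {Q \<in> K. norm (\<phi> Q - Q) \<le> d}" for d
    proof -
      have "{Q \<in> K. norm (\<phi> Q - Q) \<le> d} = K \<inter> {Q \<in> ?B. norm (conjugate F T Q - Q) \<le> d}"
        by (auto simp: T K_def)
      then show ?thesis using closed closedin_conjugate_diff_le[OF T(1)] by (simp add: closedin_Int)
    qed
  qed
  then obtain Q where Q: "Q \<in> K" and fixed: "\<And>T. T \<in> \<T> \<Longrightarrow> conjugate F T Q = Q" by blast
  obtain T where "T \<in> \<T>" using semigroup by (auto simp: abelian_operator_semigroup_def)
  \<comment> \<open>The point \<open>Q\<close> is one of its own conjugates, and those have norm at most \<open>c\<close>.\<close>
  then have "norm Q \<le> c" using Q fixed by (force simp: K_def)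
  then show ?thesis
    using Q fixed by (auto simp: K_def projection_onto_iff commutes_with_all_iff c_def)
qed

text \<open>
  Only projections no larger than \<open>P\<close> compete for the minimum, and those lie in a compact ball.
\<close>

theorem minimal_commuting_projection_exists:
  assumes P: "projection_onto sE F P" "commutes_with_all P \<T>"
  shows "\<exists>Q. projection_onto sE F Q \<and> commutes_with_all Q \<T> \<and>
    (\<forall>R. projection_onto sE F R \<and> commutes_with_all R \<T> \<longrightarrow> norm Q \<le> norm R)"
proof -
  let ?B = "\<lambda>M. ops \<inter> cball 0 M"
  define N where "N M = {Q \<in> ?B M. projection_onto sE F Q \<and> commutes_with_all Q \<T>}" for M
  have T0: "\<T> \<noteq> {}" using semigroup by (simp add: abelian_operator_semigroup_def)
  have N_eq: "N M = {Q \<in> ops. \<forall>f\<in>F. Q f = f} \<inter> (\<Inter>T\<in>\<T>. {Q \<in> ?B M. norm (conjugate F T Q - Q) \<le> 0})" for M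
    using T0 by (auto simp: N_def projection_onto_iff commutes_with_all_iff)
  have closed: "closedin op_topology (N M)" for M
    unfolding N_eq by (intro closedin_Int closedin_INT closedin_projections closedin_conjugate_diff_le T0)
  have "\<exists>Q\<in>N (norm P). \<forall>R\<in>N (norm P). norm Q \<le> norm R"
  proof (rule attains_minimum_on_compactin)
    show "compactin op_topology (N (norm P))"
      by (rule closed_compactin[OF compactin_ops_ball[of "norm P"] _ closed]) (auto simp: N_def)
    show "N (norm P) \<noteq> {}" using P by (auto simp: N_def projection_onto_iff)
    show "closedin op_topology {Q \<in> N (norm P). norm Q \<le> c}" for c
    proof -
      have "{Q \<in> N (norm P). norm Q \<le> c} = N (min (norm P) c)" by (auto simp: N_def)
      then show ?thesis using closed by simp
    qed
  qed
  then obtain Q where Q: "Q \<in> N (norm P)" and min: "\<And>R. R \<in> N (norm P) \<Longrightarrow> norm Q \<le> norm R" by blast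
  have "norm Q \<le> norm R" if "projection_onto sE F R" "commutes_with_all R \<T>" for R
    using min[of R] Q that by (cases "norm R \<le> norm P") (auto simp: N_def projection_onto_iff)
  then show ?thesis using Q by (auto simp: N_def)
qed

end

theorem theorem1p1:
  fixes sE :: "'k::{real_normed_field,heine_borel} \<Rightarrow> 'e::banach \<Rightarrow> 'e"
    and sG :: "'k \<Rightarrow> 'g::banach \<Rightarrow> 'g"
    and F :: "'e set"
    and J :: "'e \<Rightarrow> ('g \<Rightarrow>\<^sub>L 'k)"
    and \<T> :: "('e \<Rightarrow>\<^sub>L 'e) set"
  assumes E: "normed_space_over sE"
    and semigroup: "abelian_operator_semigroup sE \<T>"
    and F: "module.subspace sE F" "closed F"
    and iso: "\<And>T. T \<in> \<T> \<Longrightarrow>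
      blinfun_apply T ` F = F \<and> isomorphism_on sE F (blinfun_apply T)"
    and G: "normed_space_over sG"
    and dual: "isometric_isomorphism_onto_dual sE F sG J"
    and weak_star_cont: "\<And>T. T \<in> \<T> \<Longrightarrow>
      continuous_map (subtopology (weak_star_on F sG J) (F \<inter> cball 0 1)) (weak_star_on F sG J)
        (blinfun_apply T)"
    and bounded: "bdd_above
      ((\<lambda>T. norm T * onorm_on F (inv_into F (blinfun_apply T))) ` \<T>)"
  shows "((\<exists>P. projection_onto sE F P \<and> commutes_with_all P \<T>) \<longleftrightarrow> complemented sE F) \<and>
    (complemented sE F \<longrightarrow>
      (\<exists>Q. projection_onto sE F Q \<and> commutes_with_all Q \<T> \<and>
        norm Q \<le> (SUP T\<in>\<T>. norm T * onorm_on F (inv_into F (blinfun_apply T)))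
          * projection_constant sE F \<and>
        (\<forall>P. projection_onto sE F P \<and> commutes_with_all P \<T> \<longrightarrow> norm Q \<le> norm P)))"
proof -
  interpret E: normed_space_over sE by (rule E)
  interpret G: normed_space_over sG by (rule G)
  interpret dual_subspace sE sG F J
    by unfold_locales (use F dual in auto)
  have isomorphism: "dual_subspace_isomorphism sE sG F J T" if "T \<in> \<T>" for T
  proof unfold_locales
    show "T \<in> bounded_operators sE sE"
      using that semigroup unfolding abelian_operator_semigroup_def by blast
  qed (use iso[OF that] weak_star_cont[OF that] in blast)+
  interpret dual_subspace_semigroup sE sG F J \<T>
    by (intro dual_subspace_semigroup.intro dual_subspace_semigroup_axioms.intro
        dual_subspace_axioms semigroup isomorphism bounded)
  have min: "\<exists>Q. projection_onto sE F Q \<and> commutes_with_all Q \<T> \<and> norm Q \<le> bound * projection_constant sE F \<and>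
      (\<forall>P. projection_onto sE F P \<and> commutes_with_all P \<T> \<longrightarrow> norm Q \<le> norm P)"
    if complemented: "complemented sE F"
  proof -
    obtain P where P: "projection_onto sE F P" using complemented by (auto simp: complemented_def)
    then obtain R where R: "projection_onto sE F R" "commutes_with_all R \<T>"
      using commuting_projection_exists by blast
    obtain Q where Q: "projection_onto sE F Q" "commutes_with_all Q \<T>"
      and Q_min: "\<And>R. projection_onto sE F R \<Longrightarrow> commutes_with_all R \<T> \<Longrightarrow> norm Q \<le> norm R"
      using minimal_commuting_projection_exists[OF R] by blast
    have le: "norm Q \<le> bound * norm R" if "projection_onto sE F R" for R
      using commuting_projection_exists[OF that] Q_min by (meson order_trans)
    have "norm Q \<le> bound * projection_constant sE F"
    \<comment> \<open>The supremum vanishes when \<open>F\<close> is zero; otherwise it can be divided out of the infimum.\<close>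
    proof (cases "bound = 0")
      case True
      then show ?thesis using le[OF P] by simp
    next
      case False
      then have pos: "0 < bound" using bound_nonneg by linarith
      have "norm Q / bound \<le> projection_constant sE F"
        unfolding projection_constant_def
        by (rule cInf_greatest) (use P le pos in \<open>auto simp: divide_simps mult.commute\<close>)
      then show ?thesis using pos by (simp add: divide_simps mult.commute)
    qed
    then show ?thesis using Q Q_min by blast
  qed
  then show ?thesis by (auto simp: complemented_def)
qed

end
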